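(* Let $(T,<)$ be a chain (totally ordered set) with least element $0$ and greatest element $1\neq 0$. Define addition on $T$ by $a+b=\max\{a,b\}$, and multiplication by $a\cdot b=0$ if $a<1$ and $b<1$, and $a\cdot 1=1\cdot a=a$ for all $a\in T$. Then the following statements hold: (1) $(T,+,\cdot,0,1)$ is a semiring, and $\mathbf{m}=T-\{1\}$ is the only maximal ideal of $T$, with $\mathbf{m}^2=(0)$; (2) $T$ is a weak Gaussian semiring; (3) if $T$ has at most three elements, then $T$ is a Gaussian semiring; (4) if $T$ has at least four elements, then $T$ is not a subtractive semiring.
   Context: A semiring $(S,+,\cdot,0,1)$ is commutative: $(S,+,0)$ and $(S,\cdot,1)$ are commutative monoids, $1\neq 0$, multiplication distributes over addition, and $s\cdot 0=0$ for all $s$. An ideal is a nonempty subset closed under addition and under multiplication by elements of $S$. An ideal $I$ is subtractive if for all $a,b\in S$, $a+b\in I$ and $a\in I$ imply $b\in I$; $S$ is a subtractive semiring if all its ideals are subtractive. The product $IJ$ of ideals is the set of finite sums of products $ab$ with $a\in I$, $b\in J$. For $f\in S[X]$, $c(f)$ is the ideal of $S$ generated by the coefficients of $f$. $\sqrt{I}=\{s\in S: s^n\in I \text{ for some positive integer } n\}$. $S$ is Gaussian if $c(fg)=c(f)c(g)$ for all $f,g\in S[X]$, and weak Gaussian if $c(f)c(g)\subseteq\sqrt{c(fg)}$ for all $f,g\in S[X]$. *)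

theory Defs
  imports "HOL-Algebra.UnivPoly"
begin

locale commutative_semiring = semiring R + comm_monoid R for R (structure) +
  assumes one_not_zero: "\<one> \<noteq> \<zero>"

(* The ideals of HOL-Algebra are additive subgroups, hence unsuitable for semirings. *)
definition semiring_ideal :: "('a, 'm) ring_scheme \<Rightarrow> 'a set \<Rightarrow> bool" where
  "semiring_ideal R I \<longleftrightarrow>
     I \<subseteq> carrier R \<and> I \<noteq> {} \<and>
     (\<forall>a\<in>I. \<forall>b\<in>I. a \<oplus>\<^bsub>R\<^esub> b \<in> I) \<and>
     (\<forall>s\<in>carrier R. \<forall>a\<in>I. s \<otimes>\<^bsub>R\<^esub> a \<in> I)"

definition maximal_semiring_ideal :: "('a, 'm) ring_scheme \<Rightarrow> 'a set \<Rightarrow> bool" where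
  "maximal_semiring_ideal R M \<longleftrightarrow>
     semiring_ideal R M \<and> M \<noteq> carrier R \<and>
     (\<forall>J. semiring_ideal R J \<and> M \<subseteq> J \<longrightarrow> J = M \<or> J = carrier R)"

definition subtractive_ideal :: "('a, 'm) ring_scheme \<Rightarrow> 'a set \<Rightarrow> bool" where
  "subtractive_ideal R I \<longleftrightarrow>
     semiring_ideal R I \<and>
     (\<forall>a\<in>carrier R. \<forall>b\<in>carrier R. a \<oplus>\<^bsub>R\<^esub> b \<in> I \<and> a \<in> I \<longrightarrow> b \<in> I)"

definition subtractive :: "('a, 'm) ring_scheme \<Rightarrow> bool" where
  "subtractive R \<longleftrightarrow> (\<forall>I. semiring_ideal R I \<longrightarrow> subtractive_ideal R I)"

definition semiring_ideal_prod :: "('a, 'm) ring_scheme \<Rightarrow> 'a set \<Rightarrow> 'a set \<Rightarrow> 'a set" where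
  "semiring_ideal_prod R I J =
     {(\<Oplus>\<^bsub>R\<^esub>i\<in>{..<n}. a i \<otimes>\<^bsub>R\<^esub> b i) | (n::nat) a b. \<forall>i<n. a i \<in> I \<and> b i \<in> J}"

definition gen_semiring_ideal :: "('a, 'm) ring_scheme \<Rightarrow> 'a set \<Rightarrow> 'a set" where
  "gen_semiring_ideal R A = \<Inter>{I. semiring_ideal R I \<and> A \<subseteq> I}"

definition semiring_radical :: "('a, 'm) ring_scheme \<Rightarrow> 'a set \<Rightarrow> 'a set" where
  "semiring_radical R I = {s \<in> carrier R. \<exists>n::nat. n > 0 \<and> s [^]\<^bsub>R\<^esub> n \<in> I}"

(* The range also contains the zero coefficients beyond the degree; zero lies in every
   ideal, so they do not affect the ideal generated. *)
definition content :: "('a, 'm) ring_scheme \<Rightarrow> (nat \<Rightarrow> 'a) \<Rightarrow> 'a set" where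
  "content R f = gen_semiring_ideal R (range (coeff (UP R) f))"

definition gaussian :: "('a, 'm) ring_scheme \<Rightarrow> bool" where
  "gaussian R \<longleftrightarrow>
     (\<forall>f\<in>carrier (UP R). \<forall>g\<in>carrier (UP R).
        content R (f \<otimes>\<^bsub>UP R\<^esub> g) = semiring_ideal_prod R (content R f) (content R g))"

definition weak_gaussian :: "('a, 'm) ring_scheme \<Rightarrow> bool" where
  "weak_gaussian R \<longleftrightarrow>
     (\<forall>f\<in>carrier (UP R). \<forall>g\<in>carrier (UP R).
        semiring_ideal_prod R (content R f) (content R g)
          \<subseteq> semiring_radical R (content R (f \<otimes>\<^bsub>UP R\<^esub> g)))"

(* z and u are the least and the greatest element of the chain T; the last two branches
   of the multiplication apply when a or b is u. *)
definition chain_semiring :: "'a::linorder set \<Rightarrow> 'a \<Rightarrow> 'a \<Rightarrow> 'a ring" where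
  "chain_semiring T z u =
     \<lparr> carrier = T,
       mult = (\<lambda>a b. if a < u \<and> b < u then z else if a = u then b else a),
       one = u,
       zero = z,
       add = max \<rparr>"

end

theory Submission
  imports Defs
begin

text \<open>
  Addition on the chain is the maximum, so every polynomial product satisfies
  \<open>f\<^sub>i g\<^sub>j \<le> (fg)\<^sub>i\<^sub>+\<^sub>j\<close>. In this semiring an ideal is subtractive exactly when it is
  downward closed, because \<open>a \<le> b\<close> means \<open>b + a = b\<close>. Hence a subtractive ideal \<open>K\<close> that contains
  \<open>c(fg)\<close> contains all products \<open>f\<^sub>i g\<^sub>j\<close>, and therefore all of \<open>c(f)c(g)\<close>
  (lemma \<open>content_prod_subset_subtractive\<close>). Both Gaussian properties are instances of this.

  The ideals are the subsets of \<open>T\<close> that contain \<open>z\<close> and that are all of \<open>T\<close> as soon as they contain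
  \<open>u\<close> (lemma \<open>ideal_iff\<close>). Since every non-unit squares to zero, the radical of an ideal is \<open>T\<close>
  or \<open>T - {u}\<close>. Both are downward closed, so \<open>K = \<surd>c(fg)\<close> gives the weak Gaussian property.

  A proper ideal can fail to be downward closed only if it omits some \<open>a\<close> and contains some \<open>b\<close> with
  \<open>z < a < b < u\<close>. With at most three elements there is no such pair, and \<open>K = c(fg)\<close> gives the
  Gaussian property, the inclusion \<open>c(fg) \<subseteq> c(f)c(g)\<close> being true over every commutative semiring.
  With at least four elements there is such a pair, and \<open>{z, b}\<close> is an ideal that is not
  subtractive.
\<close>

section \<open>Ideals and contents in commutative semirings\<close>

lemma gen_semiring_ideal_least:
  assumes "semiring_ideal R I" "A \<subseteq> I"
  shows "gen_semiring_ideal R A \<subseteq> I"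
  using assms by (auto simp: gen_semiring_ideal_def)

lemma gen_semiring_ideal_superset: "A \<subseteq> gen_semiring_ideal R A"
  by (auto simp: gen_semiring_ideal_def)

context commutative_semiring
begin

lemma semiring_ideal_zero:
  assumes "semiring_ideal R I"
  shows "\<zero> \<in> I"
proof -
  obtain a where "a \<in> I" "a \<in> carrier R" using assms by (auto simp: semiring_ideal_def)
  then have "\<zero> \<otimes> a \<in> I" using assms zero_closed unfolding semiring_ideal_def by blast
  then show ?thesis using \<open>a \<in> carrier R\<close> by simp
qed

lemma semiring_ideal_carrier: "semiring_ideal R (carrier R)"
  by (auto simp: semiring_ideal_def)

lemma semiring_ideal_gen:
  assumes "A \<subseteq> carrier R"
  shows "semiring_ideal R (gen_semiring_ideal R A)"
proof -
  have "\<zero> \<in> gen_semiring_ideal R A"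
    by (auto simp: gen_semiring_ideal_def intro: semiring_ideal_zero)
  moreover have "gen_semiring_ideal R A \<subseteq> carrier R"
    using gen_semiring_ideal_least[OF semiring_ideal_carrier assms] .
  moreover have "a \<oplus> b \<in> gen_semiring_ideal R A"
    if "a \<in> gen_semiring_ideal R A" "b \<in> gen_semiring_ideal R A" for a b
    using that by (simp add: gen_semiring_ideal_def semiring_ideal_def)
  moreover have "s \<otimes> a \<in> gen_semiring_ideal R A"
    if "s \<in> carrier R" "a \<in> gen_semiring_ideal R A" for s a
    using that by (simp add: gen_semiring_ideal_def semiring_ideal_def)
  ultimately show ?thesis
    unfolding semiring_ideal_def by blast
qed

lemma finsum_in_semiring_ideal:
  assumes "semiring_ideal R I" "finite A" "\<And>i. i \<in> A \<Longrightarrow> f i \<in> I"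
  shows "(\<Oplus>i\<in>A. f i) \<in> I"
  using assms(2,3)
proof (induction A)
  case empty
  then show ?case using semiring_ideal_zero[OF assms(1)] by simp
next
  case (insert x A)
  have "I \<subseteq> carrier R" using assms(1) by (simp add: semiring_ideal_def)
  then have "(\<Oplus>i\<in>insert x A. f i) = f x \<oplus> (\<Oplus>i\<in>A. f i)"
    using insert by (intro finsum_insert) auto
  then show ?case using insert assms(1) by (auto simp: semiring_ideal_def)
qed

lemma semiring_ideal_prod_least:
  assumes "semiring_ideal R K" "\<And>a b. a \<in> I \<Longrightarrow> b \<in> J \<Longrightarrow> a \<otimes> b \<in> K"
  shows "semiring_ideal_prod R I J \<subseteq> K"
  using assms by (auto simp: semiring_ideal_prod_def intro!: finsum_in_semiring_ideal)

text \<open>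
  The quotient \<open>(K : B)\<close> is an ideal. It contains the generators of the first factor, hence that
  factor. Applying the quotient construction once more passes from \<open>B\<close> to the ideal it generates.
\<close>
lemma gen_semiring_ideal_prod_least:
  assumes K: "semiring_ideal R K" and A: "A \<subseteq> carrier R" and B: "B \<subseteq> carrier R"
    and AB: "\<And>a b. a \<in> A \<Longrightarrow> b \<in> B \<Longrightarrow> a \<otimes> b \<in> K"
  shows "semiring_ideal_prod R (gen_semiring_ideal R A) (gen_semiring_ideal R B) \<subseteq> K"
proof -
  have quotient_ideal: "semiring_ideal R {x \<in> carrier R. \<forall>b\<in>C. x \<otimes> b \<in> K}"
    if C: "C \<subseteq> carrier R" for C
    unfolding semiring_ideal_def
  proof (intro conjI ballI)
    have "\<zero> \<in> {x \<in> carrier R. \<forall>b\<in>C. x \<otimes> b \<in> K}"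
      using C semiring_ideal_zero[OF K] by auto
    then show "{x \<in> carrier R. \<forall>b\<in>C. x \<otimes> b \<in> K} \<noteq> {}" by blast
  next
    fix x y assume "x \<in> {x \<in> carrier R. \<forall>b\<in>C. x \<otimes> b \<in> K}"
      "y \<in> {x \<in> carrier R. \<forall>b\<in>C. x \<otimes> b \<in> K}"
    then show "x \<oplus> y \<in> {x \<in> carrier R. \<forall>b\<in>C. x \<otimes> b \<in> K}"
      using C K by (auto simp: l_distr subset_iff semiring_ideal_def)
  next
    fix s x assume "s \<in> carrier R" "x \<in> {x \<in> carrier R. \<forall>b\<in>C. x \<otimes> b \<in> K}"
    then show "s \<otimes> x \<in> {x \<in> carrier R. \<forall>b\<in>C. x \<otimes> b \<in> K}"
      using C K by (auto simp: m_assoc subset_iff semiring_ideal_def)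
  qed auto
  have left: "gen_semiring_ideal R A \<subseteq> {x \<in> carrier R. \<forall>b\<in>B. x \<otimes> b \<in> K}"
    using A AB by (intro gen_semiring_ideal_least[OF quotient_ideal[OF B]]) auto
  then have gen_A: "gen_semiring_ideal R A \<subseteq> carrier R" by (rule subset_trans) auto
  have "gen_semiring_ideal R B \<subseteq> {y \<in> carrier R. \<forall>a\<in>gen_semiring_ideal R A. y \<otimes> a \<in> K}"
  proof (intro gen_semiring_ideal_least[OF quotient_ideal[OF gen_A]] subsetI CollectI conjI ballI)
    fix b a assume "b \<in> B" "a \<in> gen_semiring_ideal R A"
    then show "b \<otimes> a \<in> K" using left B by (auto simp: m_comm subset_iff)
  qed (use B in auto)
  then have "b \<otimes> a \<in> K \<and> a \<in> carrier R \<and> b \<in> carrier R"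
    if "a \<in> gen_semiring_ideal R A" "b \<in> gen_semiring_ideal R B" for a b
    using that gen_A by blast
  then show ?thesis
    by (intro semiring_ideal_prod_least K) (metis m_comm)
qed

lemma prod_in_semiring_ideal_prod:
  assumes "a \<in> I" "b \<in> J" "a \<otimes> b \<in> carrier R"
  shows "a \<otimes> b \<in> semiring_ideal_prod R I J"
proof -
  have "a \<otimes> b = (\<Oplus>i\<in>{..<1::nat}. a \<otimes> b)"
    using assms(3) by (simp add: lessThan_Suc)
  then show ?thesis using assms(1,2) unfolding semiring_ideal_prod_def
    by (intro CollectI exI[of _ "1::nat"] exI[of _ "\<lambda>_. a"] exI[of _ "\<lambda>_. b"]) auto
qed

lemma semiring_ideal_semiring_ideal_prod:
  assumes I: "semiring_ideal R I" and J: "semiring_ideal R J"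
  shows "semiring_ideal R (semiring_ideal_prod R I J)" (is "semiring_ideal R ?P")
proof -
  have IR: "I \<subseteq> carrier R" and JR: "J \<subseteq> carrier R"
    using I J by (auto simp: semiring_ideal_def)
  have mem: "(\<Oplus>i\<in>{..<n}. a i \<otimes> b i) \<in> carrier R" if "\<forall>i<n. a i \<in> I \<and> b i \<in> J"
    for n :: nat and a b
    using that IR JR by (intro finsum_closed) auto
  \<comment> \<open>Closure under addition: the products of the second sum are appended to the first one by one.\<close>
  have extend: "p \<oplus> x \<otimes> y \<in> ?P" if "p \<in> ?P" "x \<in> I" "y \<in> J" for p x y
  proof -
    obtain n :: nat and a b where p: "p = (\<Oplus>i\<in>{..<n}. a i \<otimes> b i)"
      and ab: "\<forall>i<n. a i \<in> I \<and> b i \<in> J"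
      using \<open>p \<in> ?P\<close> by (auto simp: semiring_ideal_prod_def)
    let ?a = "a(n := x)" and ?b = "b(n := y)"
    have ab': "\<forall>i<Suc n. ?a i \<in> I \<and> ?b i \<in> J" using ab that by (auto simp: less_Suc_eq)
    have "(\<Oplus>i\<in>{..<Suc n}. ?a i \<otimes> ?b i) = x \<otimes> y \<oplus> (\<Oplus>i\<in>{..<n}. ?a i \<otimes> ?b i)"
      unfolding lessThan_Suc using ab that IR JR
      by (subst finsum_insert) (auto simp: subset_iff)
    also have "(\<Oplus>i\<in>{..<n}. ?a i \<otimes> ?b i) = p"
      unfolding p using ab IR JR by (intro finsum_cong') (auto simp: subset_iff)
    also have "x \<otimes> y \<oplus> p = p \<oplus> x \<otimes> y"
      using that IR JR mem[OF ab] by (auto simp: p subset_iff intro!: a_comm)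
    finally have "p \<oplus> x \<otimes> y = (\<Oplus>i\<in>{..<Suc n}. ?a i \<otimes> ?b i)" by simp
    then show ?thesis using ab' unfolding semiring_ideal_prod_def by blast
  qed
  have PR: "?P \<subseteq> carrier R" using mem by (auto simp: semiring_ideal_prod_def)
  have sum: "p \<oplus> (\<Oplus>i\<in>{..<n}. a i \<otimes> b i) \<in> ?P"
    if "p \<in> ?P" "\<forall>i<n. a i \<in> I \<and> b i \<in> J" for p and n :: nat and a b
    using that(2)
  proof (induction n)
    case 0
    then show ?case using \<open>p \<in> ?P\<close> PR by auto
  next
    case (Suc n)
    let ?s = "\<Oplus>i\<in>{..<n}. a i \<otimes> b i"
    have in_R: "a n \<otimes> b n \<in> carrier R" "p \<in> carrier R" "?s \<in> carrier R"
      using Suc.prems IR JR PR \<open>p \<in> ?P\<close> by (auto intro!: mem simp: subset_iff)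
    have "(\<Oplus>i\<in>{..<Suc n}. a i \<otimes> b i) = a n \<otimes> b n \<oplus> ?s"
      unfolding lessThan_Suc using Suc.prems in_R IR JR
      by (subst finsum_insert) (auto simp: subset_iff)
    also have "p \<oplus> \<dots> = (p \<oplus> ?s) \<oplus> a n \<otimes> b n"
      using in_R by (simp add: a_ac)
    finally show ?case using extend Suc by simp
  qed
  have scale: "s \<otimes> p \<in> ?P" if "s \<in> carrier R" "p \<in> ?P" for s p
  proof -
    obtain n :: nat and a b where p: "p = (\<Oplus>i\<in>{..<n}. a i \<otimes> b i)"
      and ab: "\<forall>i<n. a i \<in> I \<and> b i \<in> J"
      using \<open>p \<in> ?P\<close> by (auto simp: semiring_ideal_prod_def)
    have "s \<otimes> p = (\<Oplus>i\<in>{..<n}. s \<otimes> (a i \<otimes> b i))"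
      unfolding p using ab IR JR that by (intro finsum_rdistr) auto
    also have "\<dots> = (\<Oplus>i\<in>{..<n}. (s \<otimes> a i) \<otimes> b i)"
      using ab IR JR that by (intro finsum_cong') (auto simp: m_assoc subset_iff)
    finally have "s \<otimes> p = (\<Oplus>i\<in>{..<n}. (s \<otimes> a i) \<otimes> b i)" .
    moreover have "\<forall>i<n. s \<otimes> a i \<in> I \<and> b i \<in> J"
      using ab I \<open>s \<in> carrier R\<close> by (simp add: semiring_ideal_def)
    ultimately show ?thesis
      unfolding semiring_ideal_prod_def
      by (intro CollectI exI[of _ n] exI[of _ "\<lambda>i. s \<otimes> a i"] exI[of _ b] conjI)
  qed
  have "\<zero> \<otimes> \<zero> \<in> ?P"
    by (intro prod_in_semiring_ideal_prod semiring_ideal_zero I J) simp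
  then have "?P \<noteq> {}" by blast
  moreover have "p \<oplus> q \<in> ?P" if "p \<in> ?P" "q \<in> ?P" for p q
  proof -
    obtain n :: nat and a b where "q = (\<Oplus>i\<in>{..<n}. a i \<otimes> b i)"
      and "\<forall>i<n. a i \<in> I \<and> b i \<in> J"
      using \<open>q \<in> ?P\<close> by (auto simp: semiring_ideal_prod_def)
    then show ?thesis using sum[OF \<open>p \<in> ?P\<close>] by blast
  qed
  ultimately show ?thesis using PR scale by (auto simp: semiring_ideal_def)
qed

lemma UP_carrier_coeff:
  assumes "f \<in> carrier (UP R)"
  shows "coeff (UP R) f i = f i" "f i \<in> carrier R"
  using assms by (auto simp: UP_def up_def)

text \<open>
  Over a semiring the convolution of two polynomials vanishes beyond the sum of their degree bounds,
  so the product is again a polynomial and its coefficients are those of the convolution.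
\<close>
lemma UP_coeff_mult:
  assumes f: "f \<in> carrier (UP R)" and g: "g \<in> carrier (UP R)"
  shows "coeff (UP R) (f \<otimes>\<^bsub>UP R\<^esub> g) k = (\<Oplus>i\<in>{..k}. f i \<otimes> g (k - i))"
proof -
  let ?h = "\<lambda>k. \<Oplus>i\<in>{..k}. f i \<otimes> g (k - i)"
  have up: "f \<in> up R" "g \<in> up R" using f g by (auto simp: UP_def)
  obtain m n where m: "bound \<zero> m f" and n: "bound \<zero> n g"
    using up by (auto simp: up_def)
  have "bound \<zero> (m + n) ?h"
  proof
    fix k assume k: "m + n < k"
    have "f i \<otimes> g (k - i) = \<zero>" for i
    proof (cases "m < i")
      case True
      then have "f i = \<zero>" using m by (auto simp: bound_def)
      then show ?thesis using UP_carrier_coeff(2)[OF g] by simp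
    next
      case False
      then have "n < k - i" using k by linarith
      then have "g (k - i) = \<zero>" using n by (auto simp: bound_def)
      then show ?thesis using UP_carrier_coeff(2)[OF f] by simp
    qed
    then show "?h k = \<zero>" by simp
  qed
  moreover have "?h k \<in> carrier R" for k
    using f g by (intro finsum_closed) (auto simp: UP_carrier_coeff)
  ultimately have "?h \<in> up R" by (auto simp: up_def)
  then show ?thesis using up by (auto simp: UP_def)
qed

lemma semiring_ideal_content:
  assumes "f \<in> carrier (UP R)"
  shows "semiring_ideal R (content R f)"
  unfolding content_def using assms by (intro semiring_ideal_gen) (auto simp: UP_carrier_coeff)

lemma coeff_in_content:
  assumes "f \<in> carrier (UP R)"
  shows "f i \<in> content R f"
  using gen_semiring_ideal_superset[of "range (coeff (UP R) f)" R] UP_carrier_coeff(1)[OF assms]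
  unfolding content_def by (metis rangeI subset_iff)

lemma content_mult_subset:
  assumes f: "f \<in> carrier (UP R)" and g: "g \<in> carrier (UP R)"
  shows "content R (f \<otimes>\<^bsub>UP R\<^esub> g) \<subseteq> semiring_ideal_prod R (content R f) (content R g)"
    (is "_ \<subseteq> ?P")
proof -
  have P: "semiring_ideal R ?P"
    using f g by (intro semiring_ideal_semiring_ideal_prod semiring_ideal_content)
  have "f i \<otimes> g j \<in> ?P" for i j
    using f g by (intro prod_in_semiring_ideal_prod coeff_in_content m_closed UP_carrier_coeff(2))
  then have "range (coeff (UP R) (f \<otimes>\<^bsub>UP R\<^esub> g)) \<subseteq> ?P"
    using f g by (auto simp: UP_coeff_mult intro!: finsum_in_semiring_ideal[OF P])
  then show ?thesis
    unfolding content_def[of R "f \<otimes>\<^bsub>UP R\<^esub> g"] by (rule gen_semiring_ideal_least[OF P])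
qed

lemma content_prod_least:
  assumes "semiring_ideal R K" "f \<in> carrier (UP R)" "g \<in> carrier (UP R)"
    and "\<And>i j. f i \<otimes> g j \<in> K"
  shows "semiring_ideal_prod R (content R f) (content R g) \<subseteq> K"
  unfolding content_def
  using assms by (intro gen_semiring_ideal_prod_least) (auto simp: UP_carrier_coeff)

end

section \<open>The semiring of a bounded chain\<close>

locale bounded_chain =
  fixes T :: "'a::linorder set" and z u :: 'a
  assumes least: "z \<in> T" "a \<in> T \<Longrightarrow> z \<le> a"
    and greatest: "u \<in> T" "a \<in> T \<Longrightarrow> a \<le> u"
    and nontrivial: "u \<noteq> z"
begin

abbreviation S where "S \<equiv> chain_semiring T z u"

lemma carrier_S [simp]: "carrier S = T"
  and add_S [simp]: "a \<oplus>\<^bsub>S\<^esub> b = max a b"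
  and zero_S [simp]: "\<zero>\<^bsub>S\<^esub> = z"
  and one_S [simp]: "\<one>\<^bsub>S\<^esub> = u"
  by (auto simp: chain_semiring_def)

lemma mult_S:
  assumes "a \<in> T" "b \<in> T"
  shows "a \<otimes>\<^bsub>S\<^esub> b = (if a = u then b else if b = u then a else z)"
  using assms greatest by (force simp: chain_semiring_def)

lemma commutative_semiring_S: "commutative_semiring S"
proof -
  interpret abelian_monoid S
  proof (rule abelian_monoidI)
    show "a \<oplus>\<^bsub>S\<^esub> b \<in> carrier S" if "a \<in> carrier S" "b \<in> carrier S" for a b
      using that by (simp add: max_def)
  qed (use least in \<open>auto simp: max.assoc max.commute max.left_commute max_absorb2\<close>)
  interpret comm_monoid S
    using least greatest nontrivial by (intro comm_monoidI) (auto simp: mult_S)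
  show ?thesis
    using least greatest nontrivial
    by unfold_locales (auto simp: mult_S max_def dest: order.antisym)
qed

sublocale commutative_semiring "chain_semiring T z u"
  by (rule commutative_semiring_S)

text \<open>
  For \<open>a \<noteq> u\<close> every multiple of \<open>a\<close> is \<open>z\<close> or \<open>a\<close> itself, and a sum of two elements is one of them,
  so a set that contains \<open>z\<close> and omits \<open>u\<close> is closed under both operations.
\<close>
lemma ideal_iff: "semiring_ideal S I \<longleftrightarrow> I \<subseteq> T \<and> z \<in> I \<and> (u \<in> I \<longrightarrow> I = T)"
proof
  assume I: "semiring_ideal S I"
  have "I = T" if "u \<in> I"
  proof -
    have "s \<in> I" if "s \<in> T" for s
    proof -
      have "s \<otimes>\<^bsub>S\<^esub> u \<in> I" using I \<open>u \<in> I\<close> that by (auto simp: semiring_ideal_def)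
      then show ?thesis using that greatest by (simp add: mult_S split: if_splits)
    qed
    then show ?thesis using I by (auto simp: semiring_ideal_def)
  qed
  then show "I \<subseteq> T \<and> z \<in> I \<and> (u \<in> I \<longrightarrow> I = T)"
    using I semiring_ideal_zero[OF I] by (auto simp: semiring_ideal_def)
next
  assume I: "I \<subseteq> T \<and> z \<in> I \<and> (u \<in> I \<longrightarrow> I = T)"
  then have "s \<otimes>\<^bsub>S\<^esub> a \<in> I" if "s \<in> T" "a \<in> I" for s a
    using that by (subst mult_S) auto
  then show "semiring_ideal S I"
    using I by (auto simp: semiring_ideal_def max_def)
qed

lemma subtractive_ideal_iff:
  "subtractive_ideal S I \<longleftrightarrow> semiring_ideal S I \<and> (\<forall>b\<in>I. \<forall>a\<in>T. a \<le> b \<longrightarrow> a \<in> I)"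
proof (cases "semiring_ideal S I")
  case True
  then have "I \<subseteq> T" by (simp add: ideal_iff)
  have "(\<forall>b\<in>T. \<forall>a\<in>T. max b a \<in> I \<and> b \<in> I \<longrightarrow> a \<in> I) \<longleftrightarrow> (\<forall>b\<in>I. \<forall>a\<in>T. a \<le> b \<longrightarrow> a \<in> I)"
  proof
    assume sub: "\<forall>b\<in>T. \<forall>a\<in>T. max b a \<in> I \<and> b \<in> I \<longrightarrow> a \<in> I"
    show "\<forall>b\<in>I. \<forall>a\<in>T. a \<le> b \<longrightarrow> a \<in> I"
    proof (intro ballI impI)
      fix b a assume "b \<in> I" "a \<in> T" "a \<le> b"
      then show "a \<in> I" using sub \<open>I \<subseteq> T\<close> by (metis max.absorb1 subsetD)
    qed
  next
    assume down: "\<forall>b\<in>I. \<forall>a\<in>T. a \<le> b \<longrightarrow> a \<in> I"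
    show "\<forall>b\<in>T. \<forall>a\<in>T. max b a \<in> I \<and> b \<in> I \<longrightarrow> a \<in> I"
      using down by (metis max.cobounded2)
  qed
  then show ?thesis using True by (simp add: subtractive_ideal_def)
qed (simp add: subtractive_ideal_def)

lemma finsum_S_upper:
  assumes "finite A" "i \<in> A" "\<And>i. i \<in> A \<Longrightarrow> f i \<in> T"
  shows "f i \<le> (\<Oplus>\<^bsub>S\<^esub>i\<in>A. f i)"
proof -
  have "(\<Oplus>\<^bsub>S\<^esub>i\<in>insert i (A - {i}). f i) = max (f i) (\<Oplus>\<^bsub>S\<^esub>i\<in>A - {i}. f i)"
    using assms by (subst finsum_insert) auto
  then show ?thesis using assms(2) by (simp add: insert_absorb)
qed

text \<open>
  The summand \<open>f\<^sub>i g\<^sub>j\<close> lies below the coefficient \<open>(fg)\<^sub>i\<^sub>+\<^sub>j\<close>, so downward closure recovers every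
  generator of \<open>c(f)c(g)\<close> from the coefficients of \<open>fg\<close>.
\<close>
lemma content_prod_subset_subtractive:
  assumes K: "subtractive_ideal S K"
    and f: "f \<in> carrier (UP S)" and g: "g \<in> carrier (UP S)"
    and fg: "content S (f \<otimes>\<^bsub>UP S\<^esub> g) \<subseteq> K"
  shows "semiring_ideal_prod S (content S f) (content S g) \<subseteq> K"
proof (rule content_prod_least[OF _ f g])
  show "semiring_ideal S K" using K by (simp add: subtractive_ideal_def)
  fix i j
  have T: "f i \<otimes>\<^bsub>S\<^esub> g j \<in> T" for i j
    using m_closed UP_carrier_coeff(2) f g by (metis carrier_S)
  have "f i \<otimes>\<^bsub>S\<^esub> g (i + j - i) \<le> (\<Oplus>\<^bsub>S\<^esub>l\<in>{..i + j}. f l \<otimes>\<^bsub>S\<^esub> g (i + j - l))"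
    by (rule finsum_S_upper) (auto intro: T)
  moreover have "(\<Oplus>\<^bsub>S\<^esub>l\<in>{..i + j}. f l \<otimes>\<^bsub>S\<^esub> g (i + j - l)) \<in> content S (f \<otimes>\<^bsub>UP S\<^esub> g)"
    using gen_semiring_ideal_superset[of "range (coeff (UP S) (f \<otimes>\<^bsub>UP S\<^esub> g))" S]
    unfolding content_def UP_coeff_mult[OF f g, symmetric] by blast
  ultimately show "f i \<otimes>\<^bsub>S\<^esub> g j \<in> K"
    using K fg T by (auto simp: subtractive_ideal_iff)
qed

text \<open>Every element below \<open>u\<close> squares to zero, and the powers of \<open>u\<close> are \<open>u\<close>.\<close>
lemma radical_S:
  assumes I: "semiring_ideal S I"
  shows "semiring_radical S I = (if u \<in> I then T else T - {u})"
proof -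
  have "\<exists>n::nat>0. s [^]\<^bsub>S\<^esub> n \<in> I" if "s \<in> T" "s \<noteq> u" for s
  proof (intro exI[of _ "2::nat"] conjI)
    have "s [^]\<^bsub>S\<^esub> (2::nat) = z"
      using that greatest by (simp add: numeral_2_eq_2 mult_S)
    then show "s [^]\<^bsub>S\<^esub> (2::nat) \<in> I" using I by (simp add: ideal_iff)
  qed simp
  moreover have pow_u: "u [^]\<^bsub>S\<^esub> n = u" for n :: nat
    using nat_pow_one by simp
  moreover have "\<exists>n::nat>0. u [^]\<^bsub>S\<^esub> n \<in> I" if "u \<in> I"
    using that pow_u by (metis zero_less_one)
  ultimately show ?thesis
    using greatest by (auto simp: semiring_radical_def) metis
qed

lemma subtractive_ideal_radical_S:
  assumes "semiring_ideal S I"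
  shows "subtractive_ideal S (semiring_radical S I)"
  using least greatest nontrivial
  by (auto simp: radical_S[OF assms] subtractive_ideal_iff ideal_iff dest: order.antisym)

lemma content_mult_closed_ideal:
  assumes "f \<in> carrier (UP S)" "g \<in> carrier (UP S)"
  shows "semiring_ideal S (content S (f \<otimes>\<^bsub>UP S\<^esub> g))"
  unfolding content_def
proof (rule semiring_ideal_gen)
  show "range (coeff (UP S) (f \<otimes>\<^bsub>UP S\<^esub> g)) \<subseteq> carrier S"
    unfolding image_subset_iff UP_coeff_mult[OF assms]
    using UP_carrier_coeff(2)[OF assms(1)] UP_carrier_coeff(2)[OF assms(2)]
    by (intro ballI finsum_closed) (simp add: m_closed[simplified])
qed

lemma weak_gaussian_S: "weak_gaussian S"
  unfolding weak_gaussian_def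
proof (intro ballI content_prod_subset_subtractive)
  fix f g assume "f \<in> carrier (UP S)" "g \<in> carrier (UP S)"
  then have I: "semiring_ideal S (content S (f \<otimes>\<^bsub>UP S\<^esub> g))"
    by (rule content_mult_closed_ideal)
  show "subtractive_ideal S (semiring_radical S (content S (f \<otimes>\<^bsub>UP S\<^esub> g)))"
    using I by (rule subtractive_ideal_radical_S)
  show "content S (f \<otimes>\<^bsub>UP S\<^esub> g) \<subseteq> semiring_radical S (content S (f \<otimes>\<^bsub>UP S\<^esub> g))"
    using I by (auto simp: radical_S ideal_iff)
qed

lemma gaussian_if_subtractive:
  assumes "subtractive S"
  shows "gaussian S"
  unfolding gaussian_def
proof (intro ballI equalityI content_mult_subset)
  fix f g assume fg: "f \<in> carrier (UP S)" "g \<in> carrier (UP S)"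
  show "semiring_ideal_prod S (content S f) (content S g) \<subseteq> content S (f \<otimes>\<^bsub>UP S\<^esub> g)"
    using assms fg content_mult_closed_ideal[OF fg]
    by (intro content_prod_subset_subtractive) (auto simp: subtractive_def)
qed

text \<open>
  Two elements strictly between \<open>z\<close> and \<open>u\<close> are what it takes to have an ideal \<open>{z, b}\<close> that skips
  some \<open>a < b\<close>.
\<close>
lemma subtractive_iff: "subtractive S \<longleftrightarrow> \<not> (\<exists>a\<in>T. \<exists>b\<in>T. z < a \<and> a < b \<and> b < u)"
proof
  assume sub: "subtractive S"
  show "\<not> (\<exists>a\<in>T. \<exists>b\<in>T. z < a \<and> a < b \<and> b < u)"
  proof
    assume "\<exists>a\<in>T. \<exists>b\<in>T. z < a \<and> a < b \<and> b < u"
    then obtain a b where ab: "a \<in> T" "b \<in> T" "z < a" "a < b" "b < u" by blast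
    then have "semiring_ideal S {z, b}" using least nontrivial by (auto simp: ideal_iff)
    then have "\<forall>x\<in>{z, b}. \<forall>a\<in>T. a \<le> x \<longrightarrow> a \<in> {z, b}"
      using sub unfolding subtractive_def subtractive_ideal_iff by blast
    then have "a \<in> {z, b}" using ab by auto
    then show False using ab by auto
  qed
next
  assume no_pair: "\<not> (\<exists>a\<in>T. \<exists>b\<in>T. z < a \<and> a < b \<and> b < u)"
  show "subtractive S"
    unfolding subtractive_def subtractive_ideal_iff
  proof (intro allI impI conjI ballI)
    fix I a b assume I: "semiring_ideal S I" and b: "b \<in> I" and a: "a \<in> T" "a \<le> b"
    have T: "b \<in> T" "z \<le> a" "b \<le> u" using I b a least greatest by (auto simp: ideal_iff)
    consider "a = z" | "a = b" | "b = u" | "z < a" "a < b" "b < u"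
      using T a by fastforce
    then show "a \<in> I"
      using I b a T no_pair by cases (auto simp: ideal_iff)
  qed
qed

lemma two_intermediate_iff_card:
  "(\<exists>a\<in>T. \<exists>b\<in>T. z < a \<and> a < b \<and> b < u) \<longleftrightarrow> infinite T \<or> card T \<ge> 4"
proof
  assume "\<exists>a\<in>T. \<exists>b\<in>T. z < a \<and> a < b \<and> b < u"
  then obtain a b where ab: "a \<in> T" "b \<in> T" "z < a" "a < b" "b < u" by blast
  have "card {z, a, b, u} \<le> card T" if "finite T"
    using that ab least greatest by (intro card_mono) auto
  moreover have "card {z, a, b, u} = 4"
  proof -
    have "z \<noteq> a" "z \<noteq> b" "z \<noteq> u" "a \<noteq> b" "a \<noteq> u" "b \<noteq> u" using ab by auto
    then show ?thesis by simp
  qed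
  ultimately show "infinite T \<or> card T \<ge> 4" by auto
next
  assume big: "infinite T \<or> card T \<ge> 4"
  have outside: "\<exists>a. a \<in> T \<and> a \<notin> D" if "card D < 4" "finite D" for D
  proof (rule ccontr)
    assume "\<not> (\<exists>a. a \<in> T \<and> a \<notin> D)"
    then have "T \<subseteq> D" by blast
    then have "finite T" "card T \<le> card D"
      using \<open>finite D\<close> by (auto intro: finite_subset card_mono)
    then show False using big \<open>card D < 4\<close> by simp
  qed
  obtain a where a: "a \<in> T" "a \<notin> {z, u}"
    using outside[of "{z, u}"] nontrivial by auto
  obtain b where b: "b \<in> T" "b \<notin> {z, u, a}"
    using outside[of "{z, u, a}"] nontrivial a by auto
  have strict: "z < x \<and> x < u" if "x \<in> T" "x \<notin> {z, u}" for x
    using that least greatest by (auto simp: order.strict_iff_order)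
  show "\<exists>a\<in>T. \<exists>b\<in>T. z < a \<and> a < b \<and> b < u"
    using a b strict[of a] strict[of b] by (cases "a < b") force+
qed

lemma maximal_ideal_S_iff: "maximal_semiring_ideal S M \<longleftrightarrow> M = T - {u}"
proof -
  have nonunits: "semiring_ideal S (T - {u})" "T - {u} \<noteq> T"
    using least greatest nontrivial by (auto simp: ideal_iff)
  have proper: "I \<subseteq> T - {u}" if "semiring_ideal S I" "I \<noteq> T" for I
    using that by (auto simp: ideal_iff)
  show ?thesis
    using nonunits proper unfolding maximal_semiring_ideal_def carrier_S
    by (metis subset_antisym)
qed

lemma nonunits_prod_S: "semiring_ideal_prod S (T - {u}) (T - {u}) = {z}"
proof
  show "semiring_ideal_prod S (T - {u}) (T - {u}) \<subseteq> {z}"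
    using least nontrivial by (intro semiring_ideal_prod_least) (auto simp: ideal_iff mult_S)
  have "semiring_ideal S (semiring_ideal_prod S (T - {u}) (T - {u}))"
    using least nontrivial by (intro semiring_ideal_semiring_ideal_prod) (auto simp: ideal_iff)
  then show "{z} \<subseteq> semiring_ideal_prod S (T - {u}) (T - {u})"
    by (simp add: ideal_iff)
qed

end

theorem proposition21:
  fixes T :: "'a::linorder set" and z u :: 'a
  assumes least: "z \<in> T" "\<forall>a\<in>T. z \<le> a"
    and greatest: "u \<in> T" "\<forall>a\<in>T. a \<le> u"
    and "u \<noteq> z"
  defines "S \<equiv> chain_semiring T z u"
  shows "(commutative_semiring S \<and>
          (\<forall>M. maximal_semiring_ideal S M \<longleftrightarrow> M = T - {u}) \<and>
          semiring_ideal_prod S (T - {u}) (T - {u}) = {z}) \<and>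
         weak_gaussian S \<and>
         (finite T \<and> card T \<le> 3 \<longrightarrow> gaussian S) \<and>
         (infinite T \<or> card T \<ge> 4 \<longrightarrow> \<not> subtractive S)"
proof -
  interpret bounded_chain T z u
    using assms by unfold_locales auto
  show ?thesis
    unfolding S_def
    using commutative_semiring_S maximal_ideal_S_iff nonunits_prod_S weak_gaussian_S
      gaussian_if_subtractive subtractive_iff two_intermediate_iff_card
    by auto
qed

end
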